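(* If $R$ is a transit function on a finite non-empty set $V$ satisfying $(P)$, $(J0)$ and $(b1)$, then the $R$-convexity $\mathcal{C}_R$ is a convex geometry.
   Context: A transit function on a finite non-empty set $V$ is a map $R:V\times V\to 2^V$ such that $u\in R(u,v)$, $R(u,v)=R(v,u)$ and $R(u,u)=\{u\}$ for all $u,v\in V$. A convexity on the finite set $V$ is a family of subsets of $V$ (called convex sets) containing $\emptyset$ and $V$ and closed under intersections; the convex hull of $A\subseteq V$ is the smallest convex set containing $A$. A set $S\subseteq V$ is $R$-convex if $R(u,v)\subseteq S$ for all $u,v\in S$; $\mathcal{C}_R$ denotes the convexity of all $R$-convex subsets of $V$. A point $k$ of a convex set $K$ is an extreme point of $K$ if $K\setminus\{k\}$ is convex. A convexity is a convex geometry if every convex set $K$ is the convex hull of the set of extreme points of $K$. Axioms on $R$: - $(P)$ (Peano axiom): for all $x,y,u,v,w\in V$ (not necessarily distinct), if $x\in R(u,v)$ and $y\in R(x,w)$, then there exists $z\in R(u,w)$ such that $y\in R(z,v)$. - $(b1)$: for all $u,v,x\in V$, if $x\in R(u,v)$ and $x\neq v$, then $v\notin R(u,x)$. - $(J0)$: for all pairwise distinct $u,v,x,y\in V$, if $x\in R(u,y)$ and $y\in R(x,v)$, then $x\in R(u,v)$. *)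

theory Defs
  imports Main "HOL.Hull"
begin

text \<open>
  The ground set \<open>V\<close> is an explicit carrier: transit functions and the axioms on them are
  relativised to \<open>V\<close>, and values of \<open>R\<close> outside \<open>V \<times> V\<close> are irrelevant.
\<close>

definition transit_function :: "'a set \<Rightarrow> ('a \<Rightarrow> 'a \<Rightarrow> 'a set) \<Rightarrow> bool" where
  "transit_function V R \<longleftrightarrow>
     (\<forall>u\<in>V. \<forall>v\<in>V. R u v \<subseteq> V \<and> u \<in> R u v \<and> R u v = R v u \<and> R u u = {u})"

definition axiom_P :: "'a set \<Rightarrow> ('a \<Rightarrow> 'a \<Rightarrow> 'a set) \<Rightarrow> bool" where
  "axiom_P V R \<longleftrightarrow>
     (\<forall>x\<in>V. \<forall>y\<in>V. \<forall>u\<in>V. \<forall>v\<in>V. \<forall>w\<in>V.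
        x \<in> R u v \<and> y \<in> R x w \<longrightarrow> (\<exists>z\<in>R u w. y \<in> R z v))"

definition axiom_b1 :: "'a set \<Rightarrow> ('a \<Rightarrow> 'a \<Rightarrow> 'a set) \<Rightarrow> bool" where
  "axiom_b1 V R \<longleftrightarrow>
     (\<forall>u\<in>V. \<forall>v\<in>V. \<forall>x\<in>V. x \<in> R u v \<and> x \<noteq> v \<longrightarrow> v \<notin> R u x)"

definition axiom_J0 :: "'a set \<Rightarrow> ('a \<Rightarrow> 'a \<Rightarrow> 'a set) \<Rightarrow> bool" where
  "axiom_J0 V R \<longleftrightarrow>
     (\<forall>u\<in>V. \<forall>v\<in>V. \<forall>x\<in>V. \<forall>y\<in>V.
        distinct [u, v, x, y] \<and> x \<in> R u y \<and> y \<in> R x v \<longrightarrow> x \<in> R u v)"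

text \<open>
  Closure is required only for nonempty subfamilies, since \<open>\<Inter>{}\<close> is \<open>UNIV\<close> rather than \<open>V\<close>;
  the empty intersection relative to \<open>V\<close> is covered by \<open>V \<in> C\<close>.
\<close>

definition convexity_on :: "'a set \<Rightarrow> 'a set set \<Rightarrow> bool" where
  "convexity_on V C \<longleftrightarrow>
     C \<subseteq> Pow V \<and> {} \<in> C \<and> V \<in> C \<and> (\<forall>F. F \<subseteq> C \<and> F \<noteq> {} \<longrightarrow> \<Inter>F \<in> C)"

definition extreme_points :: "'a set set \<Rightarrow> 'a set \<Rightarrow> 'a set" where
  "extreme_points C K = {k \<in> K. K - {k} \<in> C}"

definition convex_geometry :: "'a set \<Rightarrow> 'a set set \<Rightarrow> bool" where
  "convex_geometry V C \<longleftrightarrow>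
     convexity_on V C \<and> (\<forall>K\<in>C. K = (\<lambda>S. S \<in> C) hull (extreme_points C K))"

definition R_convexity :: "'a set \<Rightarrow> ('a \<Rightarrow> 'a \<Rightarrow> 'a set) \<Rightarrow> 'a set set" where
  "R_convexity V R = {S. S \<subseteq> V \<and> (\<forall>u\<in>S. \<forall>v\<in>S. R u v \<subseteq> S)}"

end

theory Submission
  imports Defs
begin

text \<open>
  By the Peano axiom the join of a point \<open>p\<close> with a nonempty convex set \<open>K\<close> is the union of the
  segments \<open>R k p\<close>, \<open>k \<in> K\<close>. If \<open>p \<noteq> q\<close> lay outside \<open>K\<close> with \<open>q \<in> R k p\<close> and \<open>p \<in> R k' q\<close>, then
  \<open>k = k'\<close> would contradict (b1), while \<open>k \<noteq> k'\<close> would give \<open>q \<in> R k k' \<subseteq> K\<close> by (J0). This is the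
  anti-exchange property. In a finite convexity with that property, a maximal proper convex
  subset \<open>M\<close> of \<open>K\<close> misses exactly one point of \<open>K\<close>, which is then extreme; so no such \<open>M\<close>
  contains all the extreme points of \<open>K\<close>.
\<close>

lemma convexity_on_Int:
  assumes "convexity_on V C" "A \<in> C" "B \<in> C"
  shows "A \<inter> B \<in> C"
proof -
  have "\<forall>F. F \<subseteq> C \<and> F \<noteq> {} \<longrightarrow> \<Inter>F \<in> C"
    using assms(1) unfolding convexity_on_def by simp
  from spec[OF this, of "{A, B}"] show ?thesis
    using assms(2,3) by simp
qed

lemma convexity_on_hull_mem:
  assumes "convexity_on V C" "A \<subseteq> V"
  shows "(\<lambda>S. S \<in> C) hull A \<in> C"
proof -
  \<comment> \<open>\<open>V\<close> itself belongs to this family, so the intersection defining the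
    hull is taken over a nonempty subfamily of \<open>C\<close>.\<close>
  have "{S. S \<in> C \<and> A \<subseteq> S} \<subseteq> C" "{S. S \<in> C \<and> A \<subseteq> S} \<noteq> {}"
    using assms unfolding convexity_on_def by blast+
  then show ?thesis
    using assms(1) unfolding convexity_on_def hull_def by blast
qed

text \<open>
  The separation hypothesis is the anti-exchange property: it cannot happen that both \<open>q\<close> lies in
  the hull of \<open>insert p M\<close> and \<open>p\<close> in the hull of \<open>insert q M\<close>.
\<close>

lemma convex_geometryI:
  assumes "finite V" and C: "convexity_on V C"
    and sep: "\<And>M p q. \<lbrakk>M \<in> C; p \<in> V - M; q \<in> V - M; p \<noteq> q\<rbrakk>
                \<Longrightarrow> \<exists>L\<in>C. M \<subseteq> L \<and> (p \<in> L \<longleftrightarrow> q \<notin> L)"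
  shows "convex_geometry V C"
  unfolding convex_geometry_def
proof (intro conjI ballI)
  fix K assume K: "K \<in> C"
  let ?E = "extreme_points C K"
  let ?H = "(\<lambda>S. S \<in> C) hull ?E"
  have KV: "K \<subseteq> V"
    using C K unfolding convexity_on_def by blast
  have EK: "?E \<subseteq> K"
    unfolding extreme_points_def by blast
  have HK: "?H \<subseteq> K"
    using EK K by (rule hull_minimal)
  have HC: "?H \<in> C"
    using convexity_on_hull_mem[OF C] EK KV by blast
  show "K = ?H"
  proof (rule ccontr)
    assume ne: "K \<noteq> ?H"
    \<comment> \<open>If \<open>?H\<close> is not \<open>K\<close>, then \<open>?H\<close> itself is
      a member, so a maximal member exists by finiteness.\<close>
    let ?F = "{M \<in> C. ?H \<subseteq> M \<and> M \<subset> K}"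
    have "finite ?F"
      by (rule finite_subset[of _ "Pow V"]) (use KV \<open>finite V\<close> in auto)
    moreover have "?F \<noteq> {}"
      using HC HK ne by blast
    ultimately have "\<exists>M\<in>?F. \<forall>N\<in>?F. M \<subseteq> N \<longrightarrow> M = N"
      by (rule finite_has_maximal)
    then obtain M where "M \<in> ?F" and max: "\<forall>N\<in>?F. M \<subseteq> N \<longrightarrow> M = N"
      by (elim bexE)
    then have M: "M \<in> C" "?H \<subseteq> M" "M \<subset> K" by simp_all
    then obtain p where p: "p \<in> K" "p \<notin> M" by blast
    have "q = p" if q: "q \<in> K" "q \<notin> M" for q
    proof (rule ccontr)
      assume "q \<noteq> p"
      then obtain L where L: "L \<in> C" "M \<subseteq> L" "p \<in> L \<longleftrightarrow> q \<notin> L"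
        using sep[OF M(1), of p q] KV p q by auto
      \<comment> \<open>\<open>L\<close> contains exactly one of \<open>p\<close> and
        \<open>q\<close>. The missing point puts \<open>L \<inter> K\<close> into \<open>?F\<close>,
        so maximality gives \<open>M = L \<inter> K\<close>; the other point then lies in
        \<open>M\<close>, which is absurd.\<close>
      have "L \<inter> K \<in> C"
        using C L(1) K by (rule convexity_on_Int)
      moreover have "?H \<subseteq> L \<inter> K" "M \<subseteq> L \<inter> K"
        using L(2) M(2,3) by auto
      moreover have "L \<inter> K \<subset> K"
        using L(3) p(1) q(1) by auto
      ultimately have "M = L \<inter> K"
        using max by simp
      then show False
        using L(3) p q by blast
    qed
    then have "K - {p} = M"
      using M(3) p by blast
    then have "p \<in> ?E"
      using M(1) p(1) unfolding extreme_points_def by simp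
    then have "p \<in> ?H" by (rule hull_inc)
    then show False using M(2) p(2) by (simp add: subset_iff)
  qed
qed (rule C)

lemma convexity_on_R_convexity:
  assumes "transit_function V R"
  shows "convexity_on V (R_convexity V R)"
  unfolding convexity_on_def
proof (intro conjI allI impI)
  show "V \<in> R_convexity V R"
    using assms unfolding transit_function_def R_convexity_def by blast
  fix F assume "F \<subseteq> R_convexity V R \<and> F \<noteq> {}"
  then show "\<Inter>F \<in> R_convexity V R"
    unfolding R_convexity_def by blast
qed (auto simp: R_convexity_def)

lemma axiom_PD:
  assumes "axiom_P V R" "x \<in> R u v" "y \<in> R x w" "x \<in> V" "y \<in> V" "u \<in> V" "v \<in> V" "w \<in> V"
  obtains z where "z \<in> R u w" "y \<in> R z v"
  using assms unfolding axiom_P_def by meson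

text \<open>Take \<open>w\<close> in (P) to be the shared endpoint \<open>v\<close>: the point
  \<open>z\<close> then lies in \<open>R v v\<close> and must be \<open>v\<close>.\<close>

lemma axiom_P_segment_subset:
  assumes "transit_function V R" "axiom_P V R" "u \<in> V" "v \<in> V" "x \<in> R u v"
  shows "R x v \<subseteq> R u v"
proof
  fix y assume y: "y \<in> R x v"
  have R: "R a b \<subseteq> V" "R a b = R b a" "R a a = {a}" if "a \<in> V" "b \<in> V" for a b
    using assms(1) that unfolding transit_function_def by blast+
  have V: "x \<in> V" "y \<in> V"
    using R(1) assms(3-5) y by blast+
  have "x \<in> R v u"
    using R(2) assms(3-5) by blast
  then obtain z where "z \<in> R v v" "y \<in> R z u"
    by (rule axiom_PD[OF assms(2) _ y]) (use V assms(3,4) in auto)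
  then show "y \<in> R u v"
    using R(2,3) assms(3,4) by auto
qed

text \<open>Two uses of (P) replace \<open>x\<close> by \<open>k\<close> and then \<open>y\<close>
  by \<open>k'\<close>, moving the segment \<open>R x y\<close> into \<open>K\<close> as seen from
  \<open>p\<close>.\<close>

lemma axiom_P_join_convex:
  assumes T: "transit_function V R" and P: "axiom_P V R"
    and K: "K \<in> R_convexity V R" and p: "p \<in> V"
  shows "(\<Union>k\<in>K. R k p) \<in> R_convexity V R"
  unfolding R_convexity_def
proof (intro CollectI conjI ballI subsetI)
  have KV: "K \<subseteq> V"
    using K unfolding R_convexity_def by blast
  have RV: "R u v \<subseteq> V" and sym: "R u v = R v u" if "u \<in> V" "v \<in> V" for u v
    using T that unfolding transit_function_def by blast+
  show "x \<in> V" if "x \<in> (\<Union>k\<in>K. R k p)" for x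
    using that KV RV p by blast
  fix x y z assume "x \<in> (\<Union>k\<in>K. R k p)" "y \<in> (\<Union>k\<in>K. R k p)" and z: "z \<in> R x y"
  then obtain k k' where k: "k \<in> K" "x \<in> R k p" and k': "k' \<in> K" "y \<in> R k' p" by blast
  have V: "k \<in> V" "k' \<in> V" "x \<in> V" "y \<in> V" "z \<in> V"
    using KV RV p k k' z by blast+
  obtain t where t: "t \<in> R k y" "z \<in> R t p"
    by (rule axiom_PD[OF P k(2) z]) (use V p in auto)
  have "t \<in> R y k" "t \<in> V"
    using t sym RV V by blast+
  then obtain s where s: "s \<in> R k' k" "t \<in> R s p"
    using axiom_PD[OF P k'(2), of t k] V p by blast
  have "s \<in> K"
    using s K k k' unfolding R_convexity_def by blast
  \<comment> \<open>Since \<open>t\<close> lies on \<open>R s p\<close>, the segment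
    \<open>R t p\<close> that contains \<open>z\<close> is part of \<open>R s p\<close>.\<close>
  moreover have "z \<in> R s p"
    using axiom_P_segment_subset[OF T P _ p s(2)] t(2) \<open>s \<in> K\<close> KV by blast
  ultimately show "z \<in> (\<Union>k\<in>K. R k p)" by blast
qed

lemma R_convexity_anti_exchange:
  assumes T: "transit_function V R" and P: "axiom_P V R"
    and J0: "axiom_J0 V R" and b1: "axiom_b1 V R"
    and M: "M \<in> R_convexity V R" and p: "p \<in> V - M" and q: "q \<in> V - M" and "p \<noteq> q"
  shows "\<exists>L\<in>R_convexity V R. M \<subseteq> L \<and> (p \<in> L \<longleftrightarrow> q \<notin> L)"
proof (cases "M = {}")
  case True
  \<comment> \<open>The union of segments over an empty \<open>M\<close> would not contain
    \<open>p\<close>, so the singleton serves as separator.\<close>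
  have "{p} \<in> R_convexity V R"
    using T p unfolding transit_function_def R_convexity_def by auto
  then show ?thesis
    using True \<open>p \<noteq> q\<close> by (intro bexI[of _ "{p}"]) auto
next
  case False
  let ?L = "\<lambda>x. \<Union>k\<in>M. R k x"
  have MV: "M \<subseteq> V"
    using M unfolding R_convexity_def by blast
  have ends: "u \<in> R u v" "v \<in> R u v" "R u v = R v u" if "u \<in> V" "v \<in> V" for u v
    using T that unfolding transit_function_def by metis+
  have L: "?L x \<in> R_convexity V R" "M \<subseteq> ?L x" "x \<in> ?L x" if x: "x \<in> V" for x
  proof -
    show "?L x \<in> R_convexity V R"
      using axiom_P_join_convex[OF T P M x] .
    show "M \<subseteq> ?L x"
      using ends(1)[OF _ x] MV by auto
    show "x \<in> ?L x"
      using ends(2)[OF _ x] MV False by auto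
  qed
  have V: "k \<in> V" if "k \<in> M" for k
    using MV that by blast
  \<comment> \<open>Each join contains its own apex, so one that misses the other point is the
    required separator.\<close>
  have "q \<notin> ?L p \<or> p \<notin> ?L q"
  proof (rule ccontr)
    assume "\<not> ?thesis"
    then obtain k k' where k: "k \<in> M" "q \<in> R k p" and k': "k' \<in> M" "p \<in> R k' q" by auto
    show False
    proof (cases "k = k'")
      case True
      then show False
        using b1[unfolded axiom_b1_def, rule_format, of k p q] k k' V p q \<open>p \<noteq> q\<close> by simp
    next
      case False
      have "p \<in> R q k'"
        using ends(3)[of q k'] k' V q by simp
      moreover have "distinct [k, k', q, p]"
        using False k k' p q \<open>p \<noteq> q\<close> by auto
      ultimately have "q \<in> R k k'"
        using J0[unfolded axiom_J0_def, rule_format, of k k' q p] k k' V p q by simp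
      then show False
        using M k(1) k'(1) q unfolding R_convexity_def by auto
    qed
  qed
  then show ?thesis
  proof
    assume "q \<notin> ?L p"
    then show ?thesis
      using L p by (intro bexI[of _ "?L p"]) auto
  next
    assume "p \<notin> ?L q"
    then show ?thesis
      using L q by (intro bexI[of _ "?L q"]) auto
  qed
qed

theorem theorem2p14:
  fixes V :: "'a set" and R :: "'a \<Rightarrow> 'a \<Rightarrow> 'a set"
  assumes "finite V" and "V \<noteq> {}"
    and "transit_function V R"
    and "axiom_P V R" and "axiom_J0 V R" and "axiom_b1 V R"
  shows "convex_geometry V (R_convexity V R)"
  by (rule convex_geometryI)
    (use assms convexity_on_R_convexity R_convexity_anti_exchange in \<open>simp_all\<close>)

end
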